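(* Let $X\subset\mathbb{R}^n$ be compact, let $H$ be a reproducing kernel Hilbert space of real-valued continuous functions over $X$, and let $\Gamma=\{\gamma_i:[0,T]\to X\}_{i=1}^M$ be a finite set of continuous trajectories. For $\gamma\in C([0,T],X)$ let $\Gamma_\gamma\in H$ denote the occupation kernel corresponding to $\gamma$ in $H$. The mapping $\Phi(\gamma)=\Gamma_\gamma$ is a feature map from $C([0,T],X)$ to $H$. The eigenfunctions of the kernelized covariance operator $C_\Gamma$ under this feature map can be computed by solving $\tilde K_\Gamma\alpha=\lambda M\alpha$, where $\tilde K_\Gamma$ is the centered occupation kernel Gram matrix, given by $$\tilde K_\Gamma=K-J_MK-KJ_M+J_MKJ_M,$$ where $(J_M)_{i,j}=\frac1M$ for $i,j=1,\ldots,M$ and $K=\left(\langle\Gamma_{\gamma_i},\Gamma_{\gamma_j}\rangle_H\right)_{i,j=1}^M$ is the original occupation kernel Gram matrix. In particular, if $\alpha^{(1)},\ldots,\alpha^{(N)}$, for $0<N\le M$, are eigenvectors of $\tilde K_\Gamma$ corresponding to nonzero eigenvalues $0<\lambda_1\le\cdots\le\lambda_N$, normalized such that $\lambda_k\langle\alpha^{(k)},\alpha^{(k)}\rangle_{\mathbb{R}^M}=1$ for $k=1,\ldots,N$, then the $k$-th eigenfunction $v^{(k)}$ of $C_\Gamma$ can be expressed as $$v^{(k)}=\sum_{i=1}^M\alpha^{(k)}_i\,\Gamma_{\gamma_i}\in H.$$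
   Context: A reproducing kernel Hilbert space (RKHS) over a set $X$ is a Hilbert space $H$ of real-valued functions on $X$ such that for every $x\in X$ the evaluation functional $g\mapsto g(x)$ is bounded on $H$. $C([0,T],X)$ denotes the set of continuous functions from $[0,T]$ to $X$. Occupation kernel: for $X\subset\mathbb{R}^n$ compact, $H$ an RKHS of real-valued continuous functions over $X$, and $\gamma\in C([0,T],X)$, the functional $g\mapsto\int_0^T g(\gamma(\tau))\,\mathrm{d}\tau$ on $H$ is bounded, so by the Riesz representation theorem it is represented as $\int_0^T g(\gamma(\tau))\,\mathrm{d}\tau=\langle g,\Gamma_\gamma\rangle_H$ for some $\Gamma_\gamma\in H$; $\Gamma_\gamma$ is called the occupation kernel corresponding to $\gamma$ in $H$. Feature map: for a non-empty set $Y$, a function $k:Y\times Y\to\mathbb{R}$ is a kernel function on $Y$ if there exist a real Hilbert space $H$ and a map $\Phi:Y\to H$ such that $k(y,y')=\langle\Phi(y'),\Phi(y)\rangle_H$ for all $y,y'\in Y$; $\Phi$ is then called a feature map and $H$ a feature space of $k$. Kernelized covariance operator: let $\Phi:C([0,T],X)\to H$ be a feature map taking trajectories into $H$. With $\{\Phi(\gamma_j):j=1,\ldots,M\}$ centered in $H$, i.e. $\sum_{j=1}^M\Phi(\gamma_j)=0$, the kernelized covariance operator of $\Gamma$ is $C_\Gamma=\frac1M\sum_{j=1}^M[\Phi(\gamma_j)\otimes\Phi(\gamma_j)]$, where for $u,v\in H$ the operator $[u\otimes v]$ on $H$ is given by $[u\otimes v]h=\langle h,v\rangle_H\,u$. (When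 the features are not centered, the paper's convention is to center the data by replacing the Gram matrix $K$ with $K-J_MK-KJ_M+J_MKJ_M$.) *)

theory Defs
  imports "HOL-Analysis.Analysis"
begin

text \<open>
  A Hilbert space of real-valued functions on \<open>X\<close> is given by a Hilbert space type \<open>'h\<close> and the
  evaluation \<open>ev g x\<close> of \<open>g :: 'h\<close> at \<open>x\<close>. Linearity of \<open>ev\<close> says that the vector space operations
  of \<open>'h\<close> are the pointwise ones, and injectivity says that an element of \<open>'h\<close> is determined by its
  values on \<open>X\<close>. The values \<open>ev g x\<close> for \<open>x \<notin> X\<close> are irrelevant.
\<close>

definition rkhs_on :: "'a set \<Rightarrow> ('h::{real_inner,complete_space} \<Rightarrow> 'a \<Rightarrow> real) \<Rightarrow> bool" where
  "rkhs_on X ev \<longleftrightarrow>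
     inj (\<lambda>g. restrict (ev g) X) \<and> (\<forall>x\<in>X. bounded_linear (\<lambda>g. ev g x))"

text \<open>
  \<open>C([0,T],X)\<close>; members are arbitrary outside \<open>{0..T}\<close>, where their values are never used.
\<close>

definition trajectories :: "real \<Rightarrow> 'a::topological_space set \<Rightarrow> (real \<Rightarrow> 'a) set" where
  "trajectories T X = {\<eta>. continuous_on {0..T} \<eta> \<and> \<eta> \<in> {0..T} \<rightarrow> X}"

definition is_occupation_kernel ::
  "('h::{real_inner,complete_space} \<Rightarrow> 'a \<Rightarrow> real) \<Rightarrow> real \<Rightarrow> (real \<Rightarrow> 'a) \<Rightarrow> 'h \<Rightarrow> bool" where
  "is_occupation_kernel ev T \<eta> u \<longleftrightarrow>
     (\<forall>g. ((\<lambda>\<tau>. ev g (\<eta> \<tau>)) has_integral (inner g u)) {0..T})"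

definition occupation_kernel ::
  "('h::{real_inner,complete_space} \<Rightarrow> 'a \<Rightarrow> real) \<Rightarrow> real \<Rightarrow> (real \<Rightarrow> 'a) \<Rightarrow> 'h" where
  "occupation_kernel ev T \<eta> = (THE u. is_occupation_kernel ev T \<eta> u)"

definition feature_map ::
  "'y set \<Rightarrow> ('y \<Rightarrow> 'y \<Rightarrow> real) \<Rightarrow> ('y \<Rightarrow> 'h::{real_inner,complete_space}) \<Rightarrow> bool" where
  "feature_map Y k \<Phi> \<longleftrightarrow> Y \<noteq> {} \<and> (\<forall>y\<in>Y. \<forall>y'\<in>Y. k y y' = inner (\<Phi> y') (\<Phi> y))"

definition tensor_op :: "'h::real_inner \<Rightarrow> 'h \<Rightarrow> 'h \<Rightarrow> 'h" where
  "tensor_op u v = (\<lambda>h. inner h v *\<^sub>R u)"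

text \<open>The family of trajectories is indexed by the finite type \<open>'m\<close>, so that \<open>M = CARD('m)\<close>.\<close>

definition centered_feature :: "('y \<Rightarrow> 'h::real_inner) \<Rightarrow> ('m::finite \<Rightarrow> 'y) \<Rightarrow> 'm \<Rightarrow> 'h" where
  "centered_feature \<Phi> \<gamma> j = \<Phi> (\<gamma> j) - (1 / real CARD('m)) *\<^sub>R (\<Sum>i\<in>UNIV. \<Phi> (\<gamma> i))"

definition kernelized_cov ::
  "('y \<Rightarrow> 'h::real_inner) \<Rightarrow> ('m::finite \<Rightarrow> 'y) \<Rightarrow> 'h \<Rightarrow> 'h" where
  "kernelized_cov \<Phi> \<gamma> = (\<lambda>h. (1 / real CARD('m)) *\<^sub>R
     (\<Sum>j\<in>UNIV. tensor_op (centered_feature \<Phi> \<gamma> j) (centered_feature \<Phi> \<gamma> j) h))"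

lemma kernelized_cov_centered:
  fixes \<gamma> :: "'m::finite \<Rightarrow> 'y"
  assumes "(\<Sum>j\<in>UNIV. \<Phi> (\<gamma> j)) = 0"
  shows "kernelized_cov \<Phi> \<gamma> = (\<lambda>h. (1 / real CARD('m)) *\<^sub>R
    (\<Sum>j\<in>UNIV. tensor_op (\<Phi> (\<gamma> j)) (\<Phi> (\<gamma> j)) h))"
  using assms by (simp add: kernelized_cov_def centered_feature_def)

definition gram_matrix :: "('y \<Rightarrow> 'h::real_inner) \<Rightarrow> ('m::finite \<Rightarrow> 'y) \<Rightarrow> real^'m^'m" where
  "gram_matrix \<Phi> \<gamma> = (\<chi> i j. inner (\<Phi> (\<gamma> i)) (\<Phi> (\<gamma> j)))"

definition averaging_matrix :: "real^'m^'m::finite" where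
  "averaging_matrix = (\<chi> i j. 1 / real CARD('m))"

definition centered_gram_matrix ::
  "('y \<Rightarrow> 'h::real_inner) \<Rightarrow> ('m::finite \<Rightarrow> 'y) \<Rightarrow> real^'m^'m" where
  "centered_gram_matrix \<Phi> \<gamma> =
     (let K = gram_matrix \<Phi> \<gamma>; J = averaging_matrix
      in K - J ** K - K ** J + J ** K ** J)"

definition eigenvector :: "('v::real_vector \<Rightarrow> 'v) \<Rightarrow> real \<Rightarrow> 'v \<Rightarrow> bool" where
  "eigenvector A c v \<longleftrightarrow> v \<noteq> 0 \<and> A v = c *\<^sub>R v"

end

theory Submission
  imports Defs
begin

text \<open>
  Uniform boundedness makes the evaluation functionals bounded uniformly over the compact \<open>X\<close>, so
  integration along a trajectory is a bounded functional and the Riesz theorem yields the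
  occupation kernel. The spectral part is the duality between \<open>A\<^sup>*A\<close> and \<open>AA\<^sup>*\<close> for the map \<open>A\<close>
  sending \<open>\<alpha>\<close> to the combination of the centered features with coefficients \<open>\<alpha>\<close>: up to the factor
  \<open>M\<close> these are the centered Gram matrix and the covariance operator. Eigenvectors of the centered
  Gram matrix for nonzero eigenvalues have coefficient sum zero, so for them the centered and the
  original features give the same combination.
\<close>

section \<open>Uniform boundedness principle\<close>

lemma uniform_boundedness:
  fixes f :: "'i \<Rightarrow> 'a::{real_normed_vector,complete_space} \<Rightarrow> 'b::real_normed_vector"
  assumes lin: "\<And>i. i \<in> I \<Longrightarrow> bounded_linear (f i)"
    and ptw: "\<And>x. \<exists>C. \<forall>i\<in>I. norm (f i x) \<le> C"
  obtains C where "\<And>i x. i \<in> I \<Longrightarrow> norm (f i x) \<le> C * norm x"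
proof -
  define F where "F n = {x. \<forall>i\<in>I. norm (f i x) \<le> real n}" for n
  have closed_F: "closed (F n)" for n
  proof -
    have "F n = (\<Inter>i\<in>I. {x. norm (f i x) \<le> real n})"
      by (auto simp: F_def)
    moreover have "closed {x. norm (f i x) \<le> real n}" if "i \<in> I" for i
      using linear_continuous_on[OF lin[OF that], of UNIV]
      by (intro closed_Collect_le continuous_intros) auto
    ultimately show ?thesis by auto
  qed
  have cover: "\<Union>(range F) = UNIV"
  proof -
    have "\<exists>n. x \<in> F n" for x
    proof -
      obtain C where "\<forall>i\<in>I. norm (f i x) \<le> C" using ptw by blast
      moreover obtain n where "C \<le> real n" using real_arch_simple by blast
      ultimately have "x \<in> F n" by (auto simp: F_def intro: order_trans)
      then show ?thesis ..
    qed
    then show ?thesis by auto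
  qed
  \<comment> \<open>By Baire, countably many closed sets with empty interior cannot cover a complete
    space, but the sets \<open>F n\<close> do.\<close>
  have "\<exists>n. interior (F n) \<noteq> {}"
  proof (rule ccontr)
    assume "\<not> ?thesis"
    then have "(euclidean :: 'a topology) interior_of \<Union>(range F) = {}"
      using closed_F completely_metrizable_space_euclidean
      by (intro Baire_category_alt) auto
    then show False by (simp add: cover)
  qed
  then obtain n a where "a \<in> interior (F n)" by blast
  then obtain r where r: "r > 0" "cball a r \<subseteq> F n"
    by (meson mem_interior_cball)
  \<comment> \<open>Rescaling \<open>x\<close> to norm \<open>r\<close> gives \<open>y\<close> with
    both \<open>a\<close> and \<open>a + y\<close> in the ball. So \<open>f i y\<close> is a
    difference of two values of norm at most \<open>n\<close>: hence the \<open>2 * n\<close>, and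
    undoing the scaling gives the division by \<open>r\<close>.\<close>
  have "norm (f i x) \<le> (2 * real n / r) * norm x" if i: "i \<in> I" for i x
  proof (cases "x = 0")
    case True
    then show ?thesis using linear_0[OF bounded_linear.linear[OF lin[OF i]]] by simp
  next
    case False
    interpret bounded_linear "f i" by (rule lin[OF i])
    define y where "y = (r / norm x) *\<^sub>R x"
    have "a + y \<in> F n" "a \<in> F n"
      using r False by (auto simp: y_def dist_norm intro!: subsetD[OF r(2)])
    then have bounds: "norm (f i (a + y)) \<le> n" "norm (f i a) \<le> n"
      using i by (auto simp: F_def)
    have "(r / norm x) * norm (f i x) = norm (f i (a + y) - f i a)"
      using r(1) by (simp add: y_def add scaleR)
    also have "\<dots> \<le> 2 * real n"
      using norm_triangle_ineq4[of "f i (a + y)" "f i a"] bounds by linarith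
    finally show ?thesis using r(1) False by (simp add: field_simps)
  qed
  then show thesis by (rule that)
qed

section \<open>Riesz representation\<close>

lemma parallelogram_law:
  fixes x y :: "'a::real_inner"
  shows "(norm (x - y))\<^sup>2 = 2 * (norm x)\<^sup>2 + 2 * (norm y)\<^sup>2 - (norm (x + y))\<^sup>2"
  by (simp add: power2_norm_eq_inner algebra_simps inner_commute)

lemma norm_minimal_imp_orthogonal:
  fixes x h :: "'a::real_inner"
  assumes "\<And>t. norm x \<le> norm (x + t *\<^sub>R h)"
  shows "inner h x = 0"
proof (cases "h = 0")
  case False
  define c where "c = inner h x"
  \<comment> \<open>The minimizer of the quadratic polynomial giving the squared norm of
    \<open>x + t *\<^sub>R h\<close>; there it falls below \<open>inner x x\<close> by
    \<open>c\<^sup>2 / inner h h\<close>.\<close>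
  define t where "t = - c / inner h h"
  have hh: "inner h h > 0" using False by simp
  have "inner x x \<le> inner (x + t *\<^sub>R h) (x + t *\<^sub>R h)"
    using assms[of t] by (simp add: norm_eq_sqrt_inner)
  also have "\<dots> = inner x x + 2 * t * c + t * t * inner h h"
    by (simp add: c_def inner_commute algebra_simps)
  also have "\<dots> = inner x x - c\<^sup>2 / inner h h"
    using hh by (simp add: t_def field_simps power2_eq_square)
  finally have "c\<^sup>2 / inner h h \<le> 0" by simp
  then show ?thesis
    using hh by (simp add: c_def divide_le_0_iff)
qed simp

text \<open>A minimizing sequence in a convex set is Cauchy by the parallelogram law, and continuity
  of \<open>f\<close> keeps its limit in the hyperplane. The minimizer is normal to the kernel of
  \<open>f\<close>, hence a multiple of the Riesz representer.\<close>

lemma affine_hyperplane_min_norm: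
  fixes f :: "'a::{real_inner,complete_space} \<Rightarrow> real"
  assumes "bounded_linear f" and "\<exists>z. f z \<noteq> 0"
  obtains x where "f x = 1" "\<And>y. f y = 1 \<Longrightarrow> norm x \<le> norm y"
proof -
  interpret bounded_linear f by fact
  define A where "A = {x. f x = 1}"
  define d where "d = Inf (norm ` A)"
  obtain z where z: "f z \<noteq> 0" using assms(2) by blast
  then have "(1 / f z) *\<^sub>R z \<in> A" by (simp add: A_def scaleR)
  then have ne: "A \<noteq> {}" by blast
  have bdd: "bdd_below (norm ` A)" by (rule bdd_belowI2[of _ 0]) simp
  have d_le: "d \<le> norm y" if "y \<in> A" for y
    unfolding d_def using that bdd by (intro cInf_lower) auto
  have d_nonneg: "0 \<le> d"
    unfolding d_def using ne by (intro cInf_greatest) auto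
  have "\<exists>y\<in>A. norm y < d + 1 / real (Suc n)" for n
    using cInf_lessD[of "norm ` A" "d + 1 / real (Suc n)"] ne by (auto simp: d_def)
  then obtain X where X: "\<And>n. X n \<in> A" "\<And>n. norm (X n) < d + 1 / real (Suc n)"
    by metis
  have norm_X: "(\<lambda>n. norm (X n)) \<longlonglongrightarrow> d"
  proof (rule real_tendsto_sandwich)
    show "\<forall>\<^sub>F n in sequentially. d \<le> norm (X n)" using d_le X(1) by simp
    show "\<forall>\<^sub>F n in sequentially. norm (X n) \<le> d + 1 / real (Suc n)"
      using X(2) by (simp add: less_imp_le)
    show "(\<lambda>n. d + 1 / real (Suc n)) \<longlonglongrightarrow> d"
      using tendsto_add[OF tendsto_const LIMSEQ_inverse_real_of_nat, of d]
      by (simp add: inverse_eq_divide)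
  qed simp
  have dist_X: "(norm (X m - X n))\<^sup>2 \<le> 2 * (norm (X m))\<^sup>2 + 2 * (norm (X n))\<^sup>2 - 4 * d\<^sup>2" for m n
  proof -
    \<comment> \<open>The midpoint stays in \<open>A\<close>, so its norm is at least
      \<open>d\<close>; this bounds the subtracted term of the parallelogram law.\<close>
    have "(1 / 2) *\<^sub>R (X m + X n) \<in> A"
      using X(1)[of m] X(1)[of n] by (simp add: A_def scaleR add)
    then have "2 * d \<le> norm (X m + X n)"
      using d_le by fastforce
    then have "(2 * d)\<^sup>2 \<le> (norm (X m + X n))\<^sup>2"
      using d_nonneg by (intro power_mono) auto
    then show ?thesis
      by (simp add: parallelogram_law)
  qed
  have "Cauchy X"
  proof (rule metric_CauchyI)
    fix e :: real assume e: "e > 0"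
    have "(\<lambda>n. (norm (X n))\<^sup>2) \<longlonglongrightarrow> d\<^sup>2" by (intro tendsto_intros norm_X)
    \<comment> \<open>The margin \<open>e\<^sup>2 / 4\<close> enters twice with factor 2 in
      \<open>dist_X\<close>, which adds up to \<open>e\<^sup>2\<close>.\<close>
    then have "\<forall>\<^sub>F n in sequentially. (norm (X n))\<^sup>2 < d\<^sup>2 + e\<^sup>2 / 4"
      using e by (intro order_tendstoD) auto
    then obtain N where N: "\<And>n. n \<ge> N \<Longrightarrow> (norm (X n))\<^sup>2 < d\<^sup>2 + e\<^sup>2 / 4"
      by (auto simp: eventually_sequentially)
    have "dist (X m) (X n) < e" if "m \<ge> N" "n \<ge> N" for m n
    proof -
      have "(norm (X m - X n))\<^sup>2 < e\<^sup>2"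
        using dist_X[of m n] N[OF that(1)] N[OF that(2)] by linarith
      then show ?thesis using e by (simp add: dist_norm power_less_imp_less_base)
    qed
    then show "\<exists>N. \<forall>m\<ge>N. \<forall>n\<ge>N. dist (X m) (X n) < e" by blast
  qed
  then obtain x where x: "X \<longlonglongrightarrow> x"
    using Cauchy_convergent convergent_def by blast
  have "(\<lambda>n. f (X n)) \<longlonglongrightarrow> f x" by (rule tendsto[OF x])
  then have fx: "f x = 1"
    using X(1) by (simp add: A_def LIMSEQ_const_iff)
  have "norm x = d"
    using LIMSEQ_unique tendsto_norm[OF x] norm_X by blast
  then show thesis
    using that[OF fx] d_le by (simp add: A_def)
qed

theorem riesz_representation:
  fixes f :: "'a::{real_inner,complete_space} \<Rightarrow> real"
  assumes "bounded_linear f"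
  obtains u where "\<And>y. f y = inner y u"
proof (cases "\<forall>z. f z = 0")
  case True
  then show ?thesis using that[of 0] by simp
next
  case False
  interpret bounded_linear f by fact
  obtain x where x: "f x = 1" "\<And>y. f y = 1 \<Longrightarrow> norm x \<le> norm y"
    using affine_hyperplane_min_norm[OF assms] False by blast
  have "x \<noteq> 0" using x(1) by auto
  have "f y = inner y (x /\<^sub>R inner x x)" for y
  proof -
    \<comment> \<open>The vector \<open>y - f y *\<^sub>R x\<close> lies in the kernel of
      \<open>f\<close>, so moving \<open>x\<close> along it stays in the hyperplane and cannot
      shorten \<open>x\<close>.\<close>
    have "inner (y - f y *\<^sub>R x) x = 0"
      by (rule norm_minimal_imp_orthogonal, rule x(2)) (simp add: add diff scaleR x(1))
    then show ?thesis using \<open>x \<noteq> 0\<close> by (simp add: inner_diff field_simps)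
  qed
  then show ?thesis by (rule that)
qed

section \<open>Existence and uniqueness of occupation kernels\<close>

lemma is_occupation_kernel_unique:
  assumes "is_occupation_kernel ev T \<eta> u" "is_occupation_kernel ev T \<eta> u'"
  shows "u = u'"
proof -
  have "inner g u = inner g u'" for g
    using assms has_integral_unique unfolding is_occupation_kernel_def by blast
  then have "inner (u - u') (u - u') = 0" by (simp add: inner_diff_right)
  then show ?thesis by simp
qed

text \<open>For fixed \<open>g\<close>, continuity on the compact \<open>X\<close> bounds all values
  \<open>ev g x\<close>. This is the pointwise bound from which uniform boundedness yields one
  constant for all evaluations.\<close>

lemma rkhs_on_evaluation_bound:
  assumes "compact X" "rkhs_on X ev" "\<And>g. continuous_on X (ev g)"
  obtains C where "\<And>x g. x \<in> X \<Longrightarrow> \<bar>ev g x\<bar> \<le> C * norm g"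
proof -
  have "\<exists>C. \<forall>x\<in>X. norm (ev g x) \<le> C" for g
    using compact_imp_bounded[OF compact_continuous_image[OF assms(3) assms(1)]]
    by (auto simp: bounded_iff)
  then obtain C where "\<And>x g. x \<in> X \<Longrightarrow> norm (ev g x) \<le> C * norm g"
    using uniform_boundedness[of X "\<lambda>x g. ev g x"] assms(2) unfolding rkhs_on_def by metis
  then show thesis by (intro that) simp
qed

lemma ex_occupation_kernel:
  assumes "compact X" "rkhs_on X ev" "\<And>g. continuous_on X (ev g)" "0 \<le> T"
    and \<eta>: "\<eta> \<in> trajectories T X"
  shows "\<exists>u. is_occupation_kernel ev T \<eta> u"
proof -
  have \<eta>X: "\<eta> \<tau> \<in> X" if "\<tau> \<in> {0..T}" for \<tau>
    using \<eta> that by (auto simp: trajectories_def)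
  have lin: "bounded_linear (\<lambda>g. ev g (\<eta> \<tau>))" if "\<tau> \<in> {0..T}" for \<tau>
    using assms(2) \<eta>X[OF that] by (simp add: rkhs_on_def)
  have cont: "continuous_on {0..T} (\<lambda>\<tau>. ev g (\<eta> \<tau>))" for g
    using \<eta> \<eta>X by (intro continuous_on_compose2[OF assms(3)]) (auto simp: trajectories_def)
  then have int: "(\<lambda>\<tau>. ev g (\<eta> \<tau>)) integrable_on {0..T}" for g
    by (rule integrable_continuous_interval)
  obtain C where C: "\<And>x g. x \<in> X \<Longrightarrow> \<bar>ev g x\<bar> \<le> C * norm g"
    using rkhs_on_evaluation_bound[OF assms(1-3)] by blast
  define f where "f g = integral {0..T} (\<lambda>\<tau>. ev g (\<eta> \<tau>))" for g
  have "bounded_linear f"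
  proof (rule bounded_linear_intro)
    fix g h r
    have "f (g + h) = integral {0..T} (\<lambda>\<tau>. ev g (\<eta> \<tau>) + ev h (\<eta> \<tau>))"
      unfolding f_def by (intro integral_cong) (rule linear_add[OF bounded_linear.linear[OF lin]])
    then show "f (g + h) = f g + f h"
      by (simp add: f_def integral_add int)
    have "f (r *\<^sub>R g) = integral {0..T} (\<lambda>\<tau>. r *\<^sub>R ev g (\<eta> \<tau>))"
      unfolding f_def by (intro integral_cong) (rule linear_scale[OF bounded_linear.linear[OF lin]])
    then show "f (r *\<^sub>R g) = r *\<^sub>R f g"
      by (simp add: f_def)
    \<comment> \<open>Since \<open>C\<close> does not depend on the point of \<open>X\<close>, it
      bounds the integrand at every time.\<close>
    have "norm (f g) \<le> C * norm g * (T - 0)"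
      unfolding f_def using assms(4) C \<eta>X by (intro integral_bound cont) auto
    then show "norm (f g) \<le> norm g * (C * T)" by (simp add: mult_ac)
  qed
  then obtain u where "\<And>g. f g = inner g u"
    using riesz_representation by blast
  then show ?thesis
    using int unfolding is_occupation_kernel_def f_def by (metis integrable_integral)
qed

lemma is_occupation_kernel_occupation_kernel:
  assumes "compact X" "rkhs_on X ev" "\<And>g. continuous_on X (ev g)" "0 \<le> T" "\<eta> \<in> trajectories T X"
  shows "is_occupation_kernel ev T \<eta> (occupation_kernel ev T \<eta>)"
  unfolding occupation_kernel_def
  using ex_occupation_kernel[OF assms] is_occupation_kernel_unique by (metis (lifting) theI)

section \<open>Centered Gram matrix and covariance operator\<close>

lemma sum_centered_feature:
  fixes \<gamma> :: "'m::finite \<Rightarrow> 'y"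
  shows "(\<Sum>i\<in>UNIV. centered_feature \<Phi> \<gamma> i) = 0"
  by (simp add: centered_feature_def sum_subtractf scaleR_left.sum[symmetric] flip: scaleR_scaleR)

text \<open>Multiplying by \<open>averaging_matrix\<close> on the left or right averages over the
  row or column index, so the four terms are the expansion of an inner product of two differences
  from the mean.\<close>

lemma centered_gram_matrix_nth:
  fixes \<gamma> :: "'m::finite \<Rightarrow> 'y"
  shows "centered_gram_matrix \<Phi> \<gamma> $ i $ j
    = inner (centered_feature \<Phi> \<gamma> i) (centered_feature \<Phi> \<gamma> j)"
  by (simp add: centered_gram_matrix_def Let_def gram_matrix_def averaging_matrix_def
      matrix_matrix_mult_def centered_feature_def inner_diff_left inner_diff_right
      diff_divide_distrib flip: sum_divide_distrib inner_sum_left inner_sum_right)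

context
  fixes \<Phi> :: "'y \<Rightarrow> 'h::real_inner" and \<gamma> :: "'m::finite \<Rightarrow> 'y"
begin

lemma centered_gram_matrix_vector_mult:
  "(centered_gram_matrix \<Phi> \<gamma> *v \<alpha>) $ i
    = inner (\<Sum>j\<in>UNIV. (\<alpha> $ j) *\<^sub>R centered_feature \<Phi> \<gamma> j) (centered_feature \<Phi> \<gamma> i)"
  by (simp add: matrix_vector_mult_def centered_gram_matrix_nth inner_sum_left
      mult.commute inner_commute[of "centered_feature \<Phi> \<gamma> i"])

lemma kernelized_cov_eq:
  "kernelized_cov \<Phi> \<gamma> v = (1 / real CARD('m)) *\<^sub>R
    (\<Sum>j\<in>UNIV. inner v (centered_feature \<Phi> \<gamma> j) *\<^sub>R centered_feature \<Phi> \<gamma> j)"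
  by (simp add: kernelized_cov_def tensor_op_def)

text \<open>The entries of the matrix image of \<alpha> sum to an inner product with the sum of the
  centered features, which is zero; as \<open>c\<close> is nonzero, the coefficients sum to zero.
  The two combinations differ by that coefficient sum times the mean feature.\<close>

lemma eigenvector_centered_gram_matrix_sum_eq:
  assumes "eigenvector (\<lambda>x. centered_gram_matrix \<Phi> \<gamma> *v x) c \<alpha>" "c \<noteq> 0"
  shows "(\<Sum>i\<in>UNIV. (\<alpha> $ i) *\<^sub>R \<Phi> (\<gamma> i)) = (\<Sum>i\<in>UNIV. (\<alpha> $ i) *\<^sub>R centered_feature \<Phi> \<gamma> i)"
proof -
  have "c * (\<Sum>i\<in>UNIV. \<alpha> $ i) = (\<Sum>i\<in>UNIV. (centered_gram_matrix \<Phi> \<gamma> *v \<alpha>) $ i)"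
    using assms(1) by (simp add: eigenvector_def sum_distrib_left)
  also have "\<dots> = 0"
    by (simp add: centered_gram_matrix_vector_mult sum_centered_feature flip: inner_sum_right)
  finally have "(\<Sum>i\<in>UNIV. \<alpha> $ i) = 0" using assms(2) by simp
  then show ?thesis
    by (simp add: centered_feature_def scaleR_diff_right sum_subtractf
        flip: scaleR_left.sum sum_divide_distrib)
qed

lemma inner_eigenvector_centered_feature:
  assumes "eigenvector (\<lambda>x. centered_gram_matrix \<Phi> \<gamma> *v x) c \<alpha>" "c \<noteq> 0"
  shows "inner (\<Sum>i\<in>UNIV. (\<alpha> $ i) *\<^sub>R \<Phi> (\<gamma> i)) (centered_feature \<Phi> \<gamma> j) = c * \<alpha> $ j"
  using assms centered_gram_matrix_vector_mult[of \<alpha> j]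
  by (simp add: eigenvector_def eigenvector_centered_gram_matrix_sum_eq[OF assms])

text \<open>Translates the normalization of \<alpha> into unit norm of the eigenfunction, and shows
  that the eigenfunction is nonzero.\<close>

lemma norm_eigenvector_sum:
  assumes "eigenvector (\<lambda>x. centered_gram_matrix \<Phi> \<gamma> *v x) c \<alpha>" "c \<noteq> 0"
  shows "(norm (\<Sum>i\<in>UNIV. (\<alpha> $ i) *\<^sub>R \<Phi> (\<gamma> i)))\<^sup>2 = c * inner \<alpha> \<alpha>"
proof -
  let ?v = "\<Sum>i\<in>UNIV. (\<alpha> $ i) *\<^sub>R \<Phi> (\<gamma> i)"
  \<comment> \<open>Only the second factor is rewritten with centered features, so that each term is
    an inner product already known to be \<open>c * \<alpha> $ j\<close>.\<close>
  have "inner ?v ?v = inner ?v (\<Sum>i\<in>UNIV. (\<alpha> $ i) *\<^sub>R centered_feature \<Phi> \<gamma> i)"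
    by (simp only: eigenvector_centered_gram_matrix_sum_eq[OF assms])
  also have "\<dots> = c * inner \<alpha> \<alpha>"
    by (simp add: inner_sum_right inner_eigenvector_centered_feature[OF assms] inner_vec_def
        sum_distrib_left mult_ac)
  finally show ?thesis by (simp add: power2_norm_eq_inner)
qed

lemma eigenvector_kernelized_cov:
  assumes "eigenvector (\<lambda>x. centered_gram_matrix \<Phi> \<gamma> *v x) c \<alpha>" "c \<noteq> 0"
  shows "eigenvector (kernelized_cov \<Phi> \<gamma>) (c / real CARD('m)) (\<Sum>i\<in>UNIV. (\<alpha> $ i) *\<^sub>R \<Phi> (\<gamma> i))"
    (is "eigenvector _ _ ?v")
proof -
  have "?v \<noteq> 0"
    using norm_eigenvector_sum[OF assms] assms by (auto simp: eigenvector_def)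
  moreover have "kernelized_cov \<Phi> \<gamma> ?v
      = (1 / real CARD('m)) *\<^sub>R (\<Sum>j\<in>UNIV. (c * \<alpha> $ j) *\<^sub>R centered_feature \<Phi> \<gamma> j)"
    by (simp only: kernelized_cov_eq inner_eigenvector_centered_feature[OF assms])
  then have "kernelized_cov \<Phi> \<gamma> ?v = (c / real CARD('m)) *\<^sub>R ?v"
    by (simp add: eigenvector_centered_gram_matrix_sum_eq[OF assms] scaleR_sum_right)
  ultimately show ?thesis by (simp add: eigenvector_def)
qed

lemma eigenvector_kernelized_cov_preimage:
  assumes "eigenvector (kernelized_cov \<Phi> \<gamma>) \<mu> v" "\<mu> \<noteq> 0"
  obtains \<alpha> where "eigenvector (\<lambda>x. centered_gram_matrix \<Phi> \<gamma> *v x) (\<mu> * real CARD('m)) \<alpha>"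
    "v = (\<Sum>i\<in>UNIV. (\<alpha> $ i) *\<^sub>R \<Phi> (\<gamma> i))"
proof -
  let ?M = "real CARD('m)"
  \<comment> \<open>These coefficients are read off by solving
    \<open>kernelized_cov \<Phi> \<gamma> v = \<mu> *\<^sub>R v\<close> for
    \<open>v\<close>.\<close>
  define \<alpha> :: "real^'m" where
    "\<alpha> = (\<chi> j. inner v (centered_feature \<Phi> \<gamma> j) / (\<mu> * ?M))"
  have "\<mu> *\<^sub>R v = kernelized_cov \<Phi> \<gamma> v" "v \<noteq> 0"
    using assms(1) by (simp_all add: eigenvector_def)
  then have "v = (1 / \<mu>) *\<^sub>R kernelized_cov \<Phi> \<gamma> v"
    using assms(2) by (simp flip: \<open>\<mu> *\<^sub>R v = kernelized_cov \<Phi> \<gamma> v\<close>)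
  also have "\<dots> = (\<Sum>j\<in>UNIV. (\<alpha> $ j) *\<^sub>R centered_feature \<Phi> \<gamma> j)"
    by (simp add: kernelized_cov_eq \<alpha>_def scaleR_sum_right)
  finally have v: "v = (\<Sum>j\<in>UNIV. (\<alpha> $ j) *\<^sub>R centered_feature \<Phi> \<gamma> j)" .
  have "centered_gram_matrix \<Phi> \<gamma> *v \<alpha> = (\<mu> * ?M) *\<^sub>R \<alpha>"
    using assms(2) by (simp add: vec_eq_iff centered_gram_matrix_vector_mult flip: v)
      (simp add: \<alpha>_def)
  moreover have "\<alpha> \<noteq> 0" using v \<open>v \<noteq> 0\<close> by auto
  ultimately have ev: "eigenvector (\<lambda>x. centered_gram_matrix \<Phi> \<gamma> *v x) (\<mu> * ?M) \<alpha>"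
    by (simp add: eigenvector_def)
  show thesis
    using that[OF ev] v eigenvector_centered_gram_matrix_sum_eq[OF ev] assms(2) by simp
qed

lemma bij_betw_eigenvectors:
  assumes "\<mu> \<noteq> 0"
  shows "bij_betw (\<lambda>\<alpha>. \<Sum>i\<in>UNIV. (\<alpha> $ i) *\<^sub>R \<Phi> (\<gamma> i))
    {\<alpha>. eigenvector (\<lambda>x. centered_gram_matrix \<Phi> \<gamma> *v x) (\<mu> * real CARD('m)) \<alpha>}
    {v. eigenvector (kernelized_cov \<Phi> \<gamma>) \<mu> v}"
    (is "bij_betw ?S ?A ?B")
  unfolding bij_betw_def
proof
  have nz: "\<mu> * real CARD('m) \<noteq> 0" using assms by simp
  show "inj_on ?S ?A"
  proof (rule inj_onI)
    fix \<alpha> \<beta> assume "\<alpha> \<in> ?A" "\<beta> \<in> ?A" "?S \<alpha> = ?S \<beta>"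
    \<comment> \<open>Inner products with the centered features recover the coefficients up to a
      nonzero factor, so injectivity holds on eigenvectors even if the features are linearly
      dependent.\<close>
    then have "(\<mu> * real CARD('m)) * \<alpha> $ j = (\<mu> * real CARD('m)) * \<beta> $ j" for j
      using inner_eigenvector_centered_feature[OF _ nz, of \<alpha> j]
        inner_eigenvector_centered_feature[OF _ nz, of \<beta> j] by auto
    then show "\<alpha> = \<beta>" using nz by (simp add: vec_eq_iff)
  qed
  show "?S ` ?A = ?B"
  proof
    show "?S ` ?A \<subseteq> ?B"
      using eigenvector_kernelized_cov[OF _ nz] by auto
    show "?B \<subseteq> ?S ` ?A"
      using eigenvector_kernelized_cov_preimage[OF _ assms] by blast
  qed
qed

end

text \<open>The bijection expresses that solving the matrix problem yields exactly the
  eigenfunctions for nonzero eigenvalues. There \<mu> is an eigenvalue of the operator; in the last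
  clause \<open>\<mu> k\<close> is one of the matrix, hence the division by
  \<open>M\<close>.\<close>

theorem proposition2:
  fixes X :: "(real^'n::finite) set"
    and ev :: "'h::{real_inner,complete_space} \<Rightarrow> real^'n \<Rightarrow> real"
    and T :: real
    and \<gamma> :: "'m::finite \<Rightarrow> real \<Rightarrow> real^'n"
  assumes "compact X"
    and "rkhs_on X ev"
    and "\<And>g. continuous_on X (ev g)"
    and "0 \<le> T"
    and "\<And>i. \<gamma> i \<in> trajectories T X"
  defines "\<Phi> \<equiv> occupation_kernel ev T"
    and "K\<Gamma> \<equiv> centered_gram_matrix (occupation_kernel ev T) \<gamma>"
    and "C\<Gamma> \<equiv> kernelized_cov (occupation_kernel ev T) \<gamma>"
    and "M \<equiv> real CARD('m)"
  shows
    "(\<forall>\<eta>\<in>trajectories T X. is_occupation_kernel ev T \<eta> (\<Phi> \<eta>)) \<and>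
     feature_map (trajectories T X) (\<lambda>\<eta> \<eta>'. inner (\<Phi> \<eta>') (\<Phi> \<eta>)) \<Phi> \<and>
     (\<forall>\<mu>. \<mu> \<noteq> 0 \<longrightarrow>
        bij_betw (\<lambda>\<alpha>. \<Sum>i\<in>UNIV. (\<alpha> $ i) *\<^sub>R \<Phi> (\<gamma> i))
          {\<alpha>. eigenvector (\<lambda>x. K\<Gamma> *v x) (\<mu> * M) \<alpha>}
          {v. eigenvector C\<Gamma> \<mu> v}) \<and>
     (\<forall>(N::nat) (\<alpha> :: nat \<Rightarrow> real^'m) (\<mu> :: nat \<Rightarrow> real).
        0 < N \<and> N \<le> CARD('m) \<and> mono_on {1..N} \<mu> \<and>
        (\<forall>k\<in>{1..N}. 0 < \<mu> k \<and> eigenvector (\<lambda>x. K\<Gamma> *v x) (\<mu> k) (\<alpha> k) \<and>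
                      \<mu> k * inner (\<alpha> k) (\<alpha> k) = 1) \<longrightarrow>
        (\<forall>k\<in>{1..N}.
           let v = (\<Sum>i\<in>UNIV. (\<alpha> k $ i) *\<^sub>R \<Phi> (\<gamma> i))
           in eigenvector C\<Gamma> (\<mu> k / M) v \<and> norm v = 1))"
proof (intro conjI allI ballI impI)
  fix \<eta> assume "\<eta> \<in> trajectories T X"
  then show "is_occupation_kernel ev T \<eta> (\<Phi> \<eta>)"
    unfolding \<Phi>_def using is_occupation_kernel_occupation_kernel assms(1-4) by blast
next
  show "feature_map (trajectories T X) (\<lambda>\<eta> \<eta>'. inner (\<Phi> \<eta>') (\<Phi> \<eta>)) \<Phi>"
    \<comment> \<open>Each \<open>\<gamma> i\<close> witnesses that the set of trajectories is
      non-empty.\<close>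
    using assms(5) by (auto simp: feature_map_def)
next
  fix \<mu> :: real assume "\<mu> \<noteq> 0"
  then show "bij_betw (\<lambda>\<alpha>. \<Sum>i\<in>UNIV. (\<alpha> $ i) *\<^sub>R \<Phi> (\<gamma> i))
      {\<alpha>. eigenvector (\<lambda>x. K\<Gamma> *v x) (\<mu> * M) \<alpha>} {v. eigenvector C\<Gamma> \<mu> v}"
    unfolding \<Phi>_def K\<Gamma>_def C\<Gamma>_def M_def by (rule bij_betw_eigenvectors)
next
  fix N k :: nat and \<alpha> :: "nat \<Rightarrow> real^'m" and \<mu> :: "nat \<Rightarrow> real"
  assume *: "0 < N \<and> N \<le> CARD('m) \<and> mono_on {1..N} \<mu> \<and>
    (\<forall>k\<in>{1..N}. 0 < \<mu> k \<and> eigenvector (\<lambda>x. K\<Gamma> *v x) (\<mu> k) (\<alpha> k) \<and>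
      \<mu> k * inner (\<alpha> k) (\<alpha> k) = 1)" and "k \<in> {1..N}"
  then have eig: "eigenvector (\<lambda>x. K\<Gamma> *v x) (\<mu> k) (\<alpha> k)"
    and normalized: "\<mu> k * inner (\<alpha> k) (\<alpha> k) = 1"
    by auto
  then have nz: "\<mu> k \<noteq> 0" by auto
  show "let v = (\<Sum>i\<in>UNIV. (\<alpha> k $ i) *\<^sub>R \<Phi> (\<gamma> i)) in eigenvector C\<Gamma> (\<mu> k / M) v \<and> norm v = 1"
    using eigenvector_kernelized_cov[OF eig[unfolded K\<Gamma>_def] nz]
      norm_eigenvector_sum[OF eig[unfolded K\<Gamma>_def] nz] normalized
    by (simp add: Let_def \<Phi>_def C\<Gamma>_def M_def power2_eq_1_iff)
      (smt (verit) norm_ge_zero)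
qed

end
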